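(* Let $n\ge 2$. For each $i\in\{1,\dots,n\}$ and each $k$ with $0\le k\le n-2$, the number of arithmetical $d$-structures $(d_1,\dots,d_n)$ on $\mathcal{P}_n$ with $d_i=n-k-1$ equals $B(n-2,k)$.
   Context: $\mathcal{P}_n$ is the path graph with vertices $1,\dots,n$ and edges $\{j,j+1\}$, with adjacency matrix $A$. An arithmetical structure on $\mathcal{P}_n$ is a pair $(\mathbf{d},\mathbf{r})$ of positive integer vectors in $\mathbb{Z}^n$ with $\mathbf{r}$ primitive (gcd of entries $1$) and $(\operatorname{diag}(\mathbf{d})-A)\mathbf{r}=\mathbf{0}$; $\mathbf{d}$ is called an arithmetical $d$-structure (it determines $\mathbf{r}$). For nonnegative integers $k,\ell$, the ballot number $B(k,\ell)$ is the number of lattice paths from $(0,0)$ to $(k,\ell)$ using unit east and north steps that never go above the line $y=x$. *)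

theory Defs
  imports "Jordan_Normal_Form.Matrix"
begin

text \<open>
  Vertices of the path graph are \<open>1, \<dots>, n\<close>, while vectors and matrices are indexed
  from \<open>0\<close>: the entry belonging to vertex \<open>i\<close> sits at index \<open>i - 1\<close>.
\<close>

definition path_edges :: "nat \<Rightarrow> nat set set" where
  "path_edges n = {{j, j + 1} | j. 1 \<le> j \<and> j + 1 \<le> n}"

definition path_adj :: "nat \<Rightarrow> int mat" where
  "path_adj n = mat n n (\<lambda>(i, j). if {i + 1, j + 1} \<in> path_edges n then 1 else 0)"

definition arith_structure :: "nat \<Rightarrow> int vec \<Rightarrow> int vec \<Rightarrow> bool" where
  "arith_structure n d r \<longleftrightarrow>
     d \<in> carrier_vec n \<and> r \<in> carrier_vec n \<and>
     (\<forall>j<n. d $ j > 0) \<and> (\<forall>j<n. r $ j > 0) \<and>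
     Gcd (set\<^sub>v r) = 1 \<and>
     (mat_diag n (\<lambda>j. d $ j) - path_adj n) *\<^sub>v r = 0\<^sub>v n"

definition arith_d_structures :: "nat \<Rightarrow> int vec set" where
  "arith_d_structures n = {d. \<exists>r. arith_structure n d r}"

text \<open>
  A lattice path is the list of the lattice points it visits. Since its segments are unit
  east and north steps, it stays weakly below the line \<open>y = x\<close> iff all these points do.
\<close>

definition ballot_paths :: "nat \<Rightarrow> nat \<Rightarrow> (nat \<times> nat) list set" where
  "ballot_paths k l =
     {p. p \<noteq> [] \<and> hd p = (0, 0) \<and> last p = (k, l) \<and>
         successively (\<lambda>(x, y) q. q = (x + 1, y) \<or> q = (x, y + 1)) p \<and>
         (\<forall>(x, y) \<in> set p. y \<le> x)}"

definition ballot :: "nat \<Rightarrow> nat \<Rightarrow> nat" where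
  "ballot k l = card (ballot_paths k l)"

end

theory Submission
  imports Defs
begin

text \<open>
  Put \<open>d\<^sub>0\<close> for the entry that makes \<open>(d\<^sub>0, d\<^sub>1, \<dots>, d\<^sub>n)\<close> a closed frieze cycle. The cyclic shift
  \<open>(d\<^sub>1, \<dots>, d\<^sub>n) \<mapsto> (d\<^sub>2, \<dots>, d\<^sub>n, d\<^sub>0)\<close> is an injective self-map of the finite set of
  \<open>d\<close>-structures, so the distribution of \<open>d\<^sub>i\<close> does not depend on \<open>i\<close> and equals that of
  \<open>d\<^sub>0\<close>. Together with the solution \<open>s\<close> of the same recurrence with
  \<open>s\<^sub>1 = 0\<close>, \<open>s\<^sub>2 = 1\<close>, the vector \<open>r\<close> gives fractions \<open>s\<^sub>j / r\<^sub>j\<close> that form a path of \<open>n\<close> vertices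
  in the Farey graph from \<open>0/1\<close> to \<open>d\<^sub>0/1\<close>, and every such path arises once.

  If \<open>c n m\<close> is the number of Farey paths with \<open>n\<close> vertices from \<open>0\<close> to \<open>m\<close>, then
  \<open>c n m = c (n - 1) (m - 1) + c n (m + 1)\<close>, which is the ballot recurrence: a path
  whose second vertex is \<open>1/1\<close> loses its first vertex and is translated by \<open>-1\<close>; all other
  paths pass through \<open>1/2\<close> and \<open>1/1\<close>, and a piecewise Moebius map sends \<open>0, 1/2, 1\<close> to
  \<open>0, 1, 2\<close>.
\<close>

section \<open>Ballot numbers and their recurrence\<close>

lemma ballot_paths_above: "l > k \<Longrightarrow> ballot_paths k l = {}"
  unfolding ballot_paths_def using last_in_set by fastforce

lemma ballot_paths_origin: "ballot_paths 0 0 = {[(0, 0)]}"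
proof -
  have "p = [(0, 0)]" if p: "p \<in> ballot_paths 0 0" for p
  proof (cases p rule: rev_cases)
    case Nil
    then show ?thesis using p by (simp add: ballot_paths_def)
  next
    case (snoc q x)
    then show ?thesis using p
      by (cases q rule: rev_cases) (auto simp: ballot_paths_def successively_append_iff)
  qed
  then show ?thesis by (auto simp: ballot_paths_def)
qed

lemma ballot_paths_snoc:
  assumes "q \<noteq> []"
  shows "q @ [(k, l)] \<in> ballot_paths k l \<longleftrightarrow>
    l \<le> k \<and> ((\<exists>k'. k = Suc k' \<and> q \<in> ballot_paths k' l) \<or> (\<exists>l'. l = Suc l' \<and> q \<in> ballot_paths k l'))"
  using assms by (auto simp: ballot_paths_def successively_append_iff split: prod.splits)

text \<open>Deleting the final point leaves a path to the western or southern neighbour. Each union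
  has at most one index and is empty on the boundary, so the zero cases are covered
  uniformly.\<close>

lemma ballot_paths_step:
  assumes "l \<le> k" "(k, l) \<noteq> (0, 0)"
  shows "ballot_paths k l = (\<lambda>q. q @ [(k, l)]) `
    ((\<Union>k'\<in>{k'. k = Suc k'}. ballot_paths k' l) \<union> (\<Union>l'\<in>{l'. l = Suc l'}. ballot_paths k l'))"
    (is "_ = ?f ` ?Q")
proof (intro equalityI subsetI)
  fix p assume p: "p \<in> ballot_paths k l"
  then have "p \<noteq> []" "last p = (k, l)" "hd p = (0, 0)" by (auto simp: ballot_paths_def)
  then obtain q where q: "p = q @ [(k, l)]" by (metis append_butlast_last_id)
  with \<open>hd p = (0, 0)\<close> assms(2) have "q \<noteq> []" by auto
  then show "p \<in> ?f ` ?Q" using p q ballot_paths_snoc by auto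
next
  fix p assume "p \<in> ?f ` ?Q"
  then obtain q where q: "p = q @ [(k, l)]" "q \<in> ?Q" by auto
  then have "q \<noteq> []" by (auto simp: ballot_paths_def)
  then show "p \<in> ballot_paths k l" using q assms(1) ballot_paths_snoc by auto
qed

lemma finite_ballot_paths: "finite (ballot_paths k l)"
proof (induction "k + l" arbitrary: k l rule: less_induct)
  case less
  consider "l > k" | "k = 0" "l = 0" | "l \<le> k" "(k, l) \<noteq> (0, 0)" by force
  then show ?case
  proof cases
    case 3
    have "finite (\<Union>k'\<in>{k'. k = Suc k'}. ballot_paths k' l)"
      using less by (cases k) auto
    moreover have "finite (\<Union>l'\<in>{l'. l = Suc l'}. ballot_paths k l')"
      using less by (cases l) auto
    ultimately show ?thesis by (simp add: ballot_paths_step[OF 3])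
  qed (simp_all add: ballot_paths_above ballot_paths_origin)
qed

lemma ballot_above: "l > k \<Longrightarrow> ballot k l = 0"
  by (simp add: ballot_def ballot_paths_above)

lemma ballot_origin: "ballot 0 0 = 1"
  by (simp add: ballot_def ballot_paths_origin)

lemma inj_snoc: "inj_on (\<lambda>q. q @ [x]) A"
  by (auto simp: inj_on_def)

lemma ballot_Suc_0: "ballot (Suc k) 0 = ballot k 0"
  using ballot_paths_step[of 0 "Suc k"] by (simp add: ballot_def card_image inj_snoc)

lemma ballot_Suc_Suc:
  assumes "l \<le> k"
  shows "ballot (Suc k) (Suc l) = ballot k (Suc l) + ballot (Suc k) l"
proof -
  have "ballot_paths k (Suc l) \<inter> ballot_paths (Suc k) l = {}"
    by (auto simp: ballot_paths_def)
  then show ?thesis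
    using ballot_paths_step[of "Suc l" "Suc k"] assms
    by (simp add: ballot_def card_image inj_snoc card_Un_disjoint finite_ballot_paths)
qed

section \<open>Farey paths and their steps\<close>

text \<open>A pair \<open>(p, q)\<close> stands for p/q. Determinant 1 makes consecutive fractions
  increasing Farey neighbours, automatically in lowest terms.\<close>

definition farey_paths :: "nat \<Rightarrow> int \<Rightarrow> (int \<times> int) list set" where
  "farey_paths n m = {xs. length xs = n \<and> xs ! 0 = (0, 1) \<and> xs ! (n - 1) = (m, 1) \<and>
     (\<forall>j<n. 0 < snd (xs ! j)) \<and>
     (\<forall>j. Suc j < n \<longrightarrow> fst (xs ! Suc j) * snd (xs ! j) - fst (xs ! j) * snd (xs ! Suc j) = 1)}"

lemma farey_paths_nonneg:
  assumes xs: "xs \<in> farey_paths n m" and "j < n"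
  shows "0 \<le> fst (xs ! j) \<and> (0 < j \<longrightarrow> 0 < fst (xs ! j))"
  using assms(2)
proof (induction j)
  case 0
  then show ?case using xs by (simp add: farey_paths_def)
next
  case (Suc j)
  have "fst (xs ! Suc j) * snd (xs ! j) = 1 + fst (xs ! j) * snd (xs ! Suc j)"
    "0 < snd (xs ! j)" "0 < snd (xs ! Suc j)"
    using xs Suc.prems by (auto simp: farey_paths_def algebra_simps)
  moreover have "0 \<le> fst (xs ! j)" using Suc by simp
  ultimately have "0 < fst (xs ! Suc j) * snd (xs ! j)" by (simp add: add_pos_nonneg)
  then show ?case using \<open>0 < snd (xs ! j)\<close> by (simp add: zero_less_mult_iff)
qed

text \<open>Each step raises the value by 1/(q q'), which is at most 1.\<close>

lemma farey_paths_le: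
  assumes xs: "xs \<in> farey_paths n m" and "j < n"
  shows "fst (xs ! j) \<le> int j * snd (xs ! j)"
  using assms(2)
proof (induction j)
  case 0
  then show ?case using xs by (simp add: farey_paths_def)
next
  case (Suc j)
  define p q p' q' where pq: "p = fst (xs ! j)" "q = snd (xs ! j)" "p' = fst (xs ! Suc j)" "q' = snd (xs ! Suc j)"
  have E: "p' * q = 1 + p * q'" "0 < q" "0 < q'"
    using xs Suc.prems by (auto simp: farey_paths_def algebra_simps pq)
  have "p \<le> int j * q" using Suc by (simp add: pq)
  then have "p * q' \<le> int j * q * q'" using E by (intro mult_right_mono) auto
  moreover have "1 \<le> q * q'" using E by (simp add: int_one_le_iff_zero_less)
  moreover have "((int j + 1) * q') * q = int j * q * q' + q * q'" by (simp add: algebra_simps)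
  ultimately have "p' * q \<le> ((int j + 1) * q') * q" using E(1) by linarith
  then show ?case using E(2) by (simp add: pq(3,4) add.commute)
qed

lemma farey_paths_empty_large: "int n \<le> m \<Longrightarrow> 0 < n \<Longrightarrow> farey_paths n m = {}"
proof (rule equals0I)
  fix xs assume a: "int n \<le> m" "0 < n" "xs \<in> farey_paths n m"
  with farey_paths_le[OF a(3), of "n - 1"] show False by (simp add: farey_paths_def)
qed

lemma farey_paths_empty_nonpos: "1 < n \<Longrightarrow> m \<le> 0 \<Longrightarrow> farey_paths n m = {}"
proof (rule equals0I)
  fix xs assume a: "1 < n" "m \<le> 0" "xs \<in> farey_paths n m"
  with farey_paths_nonneg[OF a(3), of "n - 1"] show False by (simp add: farey_paths_def)
qed

text \<open>If p/q < c < p'/q', integrality makes the determinant at least q + q' \<ge> 2: no Farey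
  step jumps over an integer.\<close>

lemma farey_step_le_or_ge:
  fixes c p q p' q' :: int
  assumes "p' * q - p * q' = 1" "0 < q" "0 < q'"
  shows "p' \<le> c * q' \<or> c * q \<le> p"
proof (rule ccontr)
  assume "\<not> ?thesis"
  then have "c * q' + 1 \<le> p'" "p \<le> c * q - 1" by auto
  then have "(c * q' + 1) * q \<le> p' * q" "p * q' \<le> (c * q - 1) * q'"
    using assms by (auto intro: mult_right_mono)
  then show False using assms by (simp add: algebra_simps)
qed

lemma farey_step_less:
  fixes c p q p' q' :: int
  assumes "p' * q - p * q' = 1" "0 < q" "0 < q'" "c * q \<le> p"
  shows "c * q' < p'"
proof -
  have "(c * q) * q' \<le> p * q'" using assms by (intro mult_right_mono) auto
  then have "(c * q') * q < p' * q" using assms(1) by (simp add: algebra_simps)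
  then show ?thesis using assms(2) by (simp add: mult_less_cancel_right)
qed

text \<open>Straddling 1/2 makes the determinant at least p + p', so p = 0 and p' = 1, which leaves
  only the step from 0/1 to 1/1.\<close>

lemma farey_step_half:
  fixes p q p' q' :: int
  assumes "p' * q - p * q' = 1" "0 < q" "0 < q'" "0 \<le> p" "(p, q, p', q') \<noteq> (0, 1, 1, 1)"
  shows "2 * p' \<le> q' \<or> q \<le> 2 * p"
proof (rule ccontr)
  assume "\<not> ?thesis"
  then have a: "q' \<le> 2 * p' - 1" "2 * p + 1 \<le> q" by auto
  then have "p' * (2 * p + 1) \<le> p' * q" "p * q' \<le> p * (2 * p' - 1)"
    using assms by (auto intro!: mult_left_mono)
  then have "p' + p \<le> 1" using assms(1) by (simp add: algebra_simps)
  then have "p' = 1" "p = 0" using a assms by auto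
  with assms a show False by auto
qed

section \<open>A piecewise Moebius bijection\<close>

text \<open>
  On \<open>z = p / q\<close>, \<open>flip\<close> is \<open>z / (1 - z)\<close> on \<open>[0, 1/2]\<close>, \<open>3 - 1 / z\<close> on \<open>[1/2, 1]\<close> and
  \<open>z + 1\<close> beyond. The pieces have determinant 1 and agree at the breakpoints, and no Farey step
  other than \<open>0/1 \<rightarrow> 1/1\<close> crosses a breakpoint.
\<close>

definition flip :: "int \<times> int \<Rightarrow> int \<times> int" where
  "flip = (\<lambda>(p, q). if 2 * p \<le> q then (p, q - p) else if p \<le> q then (3 * p - q, p) else (p + q, q))"

text \<open>On z = p/q the branches are z/(1 + z) on [0, 1], 1/(3 - z) on [1, 2] and z - 1 beyond.
  The breakpoints are integers, which no Farey step crosses, so \<open>unflip_step\<close> has no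
  exceptional step.\<close>

definition unflip :: "int \<times> int \<Rightarrow> int \<times> int" where
  "unflip = (\<lambda>(p, q). if p \<le> q then (p, p + q) else if p \<le> 2 * q then (q, 3 * q - p) else (p - q, q))"

lemma unflip_flip: "0 \<le> fst x \<Longrightarrow> 0 < snd x \<Longrightarrow> unflip (flip x) = x"
  by (cases x) (auto simp: flip_def unflip_def)

lemma flip_unflip: "0 \<le> fst x \<Longrightarrow> 0 < snd x \<Longrightarrow> flip (unflip x) = x"
  by (cases x) (auto simp: flip_def unflip_def)

lemma snd_flip_pos: "0 \<le> fst x \<Longrightarrow> 0 < snd x \<Longrightarrow> 0 < snd (flip x)"
  by (cases x) (auto simp: flip_def)

lemma snd_unflip_pos: "0 \<le> fst x \<Longrightarrow> 0 < snd x \<Longrightarrow> 0 < snd (unflip x)"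
  by (cases x) (auto simp: unflip_def)

lemma flip_step:
  assumes "fst y * snd x - fst x * snd y = 1" "0 < snd x" "0 < snd y" "0 \<le> fst x" 
    "(x, y) \<noteq> ((0, 1), (1, 1))"
  shows "fst (flip y) * snd (flip x) - fst (flip x) * snd (flip y) = 1"
proof -
  obtain p q p' q' where xy: "x = (p, q)" "y = (p', q')" by (meson surj_pair)
  have E: "p' * q - p * q' = 1" "0 < q" "0 < q'" "0 \<le> p"
    using assms by (auto simp: xy)
  have one: "p' \<le> q' \<or> q \<le> p" using farey_step_le_or_ge[of p' q p q' 1] E by simp
  have half: "2 * p' \<le> q' \<or> q \<le> 2 * p" using farey_step_half[of p' q p q'] E assms(5) by (auto simp: xy)
  have mono1: "q \<le> p \<Longrightarrow> q' < p'" using farey_step_less[of p' q p q' 1] E by simp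
  have mono2: "q' < 2 * p'" if "q \<le> 2 * p"
  proof -
    have "q * q' \<le> (2 * p) * q'" using that E by (intro mult_right_mono) auto
    moreover have "(2 * p') * q = 2 + (2 * p) * q'" using E(1) by (simp add: algebra_simps)
    ultimately have "q' * q < (2 * p') * q" by (simp add: mult.commute)
    then show ?thesis using E(2) by (simp add: mult_less_cancel_right)
  qed
  \<comment> \<open>The start of the step may lie on a breakpoint, where \<open>flip\<close> takes
    the earlier branch; both branches give the same pair there, so one matrix of determinant 1
    serves both ends.\<close>
  consider "2 * p \<le> q" "2 * p' \<le> q'" | "q \<le> 2 * p" "p \<le> q" "q' < 2 * p'" "p' \<le> q'" | "q \<le> p" "q' < p'"
    using one half mono1 mono2 E by linarith
  then show ?thesis
  proof cases
    case 1
    then show ?thesis using E by (simp add: flip_def xy algebra_simps)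
  next
    case 2
    then have "flip x = (3 * p - q, p)" "flip y = (3 * p' - q', p')" using E by (auto simp: flip_def xy)
    then show ?thesis using E by (simp add: algebra_simps)
  next
    case 3
    then have "flip x = (p + q, q)" "flip y = (p' + q', q')" using E by (auto simp: flip_def xy)
    then show ?thesis using E by (simp add: algebra_simps)
  qed
qed

lemma unflip_step:
  assumes "fst y * snd x - fst x * snd y = 1" "0 < snd x" "0 < snd y"
  shows "fst (unflip y) * snd (unflip x) - fst (unflip x) * snd (unflip y) = 1"
proof -
  obtain p q p' q' where xy: "x = (p, q)" "y = (p', q')" by (meson surj_pair)
  have E: "p' * q - p * q' = 1" "0 < q" "0 < q'"
    using assms by (auto simp: xy)
  have one: "p' \<le> q' \<or> q \<le> p" using farey_step_le_or_ge[of p' q p q' 1] E by simp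
  have two: "p' \<le> 2 * q' \<or> 2 * q \<le> p" using farey_step_le_or_ge[of p' q p q' 2] E by simp
  have mono: "q \<le> p \<Longrightarrow> q' < p'" "2 * q \<le> p \<Longrightarrow> 2 * q' < p'"
    using farey_step_less[of p' q p q' 1] farey_step_less[of p' q p q' 2] E by simp_all
  consider "p \<le> q" "p' \<le> q'" | "q \<le> p" "p \<le> 2 * q" "q' < p'" "p' \<le> 2 * q'" | "2 * q \<le> p" "2 * q' < p'"
    using one two mono E by linarith
  then show ?thesis
  proof cases
    case 1
    then show ?thesis using E by (simp add: unflip_def xy algebra_simps)
  next
    case 2
    then have "unflip x = (q, 3 * q - p)" "unflip y = (q', 3 * q' - p')" using E by (auto simp: unflip_def xy)
    then show ?thesis using E by (simp add: algebra_simps)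
  next
    case 3
    then have "unflip x = (p - q, q)" "unflip y = (p' - q', q')" using E by (auto simp: unflip_def xy)
    then show ?thesis using E by (simp add: algebra_simps)
  qed
qed

text \<open>As m \<ge> 1, the endpoint m/1 goes to (m + 1)/1, for m = 1 through the middle branch,
  while 0/1 is fixed.\<close>

lemma bij_betw_flip:
  assumes "1 < n" "1 \<le> m"
  shows "bij_betw (map flip) {xs \<in> farey_paths n m. xs ! 1 \<noteq> (1, 1)} (farey_paths n (m + 1))"
    (is "bij_betw _ ?A ?B")
proof (rule bij_betw_byWitness[where f' = "map unflip"])
  show "\<forall>xs\<in>?A. map unflip (map flip xs) = xs"
    using farey_paths_nonneg by (auto intro!: nth_equalityI unflip_flip simp: farey_paths_def)
  show "\<forall>xs\<in>?B. map flip (map unflip xs) = xs"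
    using farey_paths_nonneg by (auto intro!: nth_equalityI flip_unflip simp: farey_paths_def)
  show "map flip ` ?A \<subseteq> ?B"
  proof (intro image_subsetI)
    fix xs assume xs: "xs \<in> ?A"
    note nonneg = farey_paths_nonneg[of xs n m]
    \<comment> \<open>Only the first vertex has numerator 0, so the exceptional step could only come
      first, where it is excluded.\<close>
    have start: "xs ! j = (0, 1) \<longrightarrow> xs ! Suc j \<noteq> (1, 1)" if "Suc j < n" for j
      using nonneg[of j] xs that by (cases j) auto
    have "fst (flip (xs ! Suc j)) * snd (flip (xs ! j)) - fst (flip (xs ! j)) * snd (flip (xs ! Suc j)) = 1"
      if "Suc j < n" for j
      using that xs start[OF that] nonneg[of j] by (intro flip_step) (auto simp: farey_paths_def)
    moreover have "0 < snd (flip (xs ! j))" if "j < n" for j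
      using that xs nonneg[of j] by (intro snd_flip_pos) (auto simp: farey_paths_def)
    ultimately show "map flip xs \<in> ?B" using xs assms
      by (auto simp: farey_paths_def) (auto simp: flip_def)
  qed
  show "map unflip ` ?B \<subseteq> ?A"
  proof (intro image_subsetI)
    fix xs assume xs: "xs \<in> ?B"
    note nonneg = farey_paths_nonneg[of xs n "m + 1"]
    have "fst (unflip (xs ! Suc j)) * snd (unflip (xs ! j)) - fst (unflip (xs ! j)) * snd (unflip (xs ! Suc j)) = 1"
      if "Suc j < n" for j
      using that xs by (intro unflip_step) (auto simp: farey_paths_def)
    moreover have "0 < snd (unflip (xs ! j))" if "j < n" for j
      using that xs nonneg[of j] by (intro snd_unflip_pos) (auto simp: farey_paths_def)
    \<comment> \<open>The step from 0/1 forces numerator 1, whereas \<open>unflip\<close> reaches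
      1/1 only from 2/1.\<close>
    moreover have "unflip (xs ! 1) \<noteq> (1, 1)"
    proof
      assume u: "unflip (xs ! 1) = (1, 1)"
      have "0 < snd (xs ! 1)" "fst (xs ! 1) = 1"
        using xs assms by (force simp: farey_paths_def)+
      with u show False by (cases "xs ! 1") (auto simp: unflip_def split: if_splits)
    qed
    ultimately show "map unflip xs \<in> ?A" using xs assms
      by (auto simp: farey_paths_def) (auto simp: unflip_def)
  qed
qed

lemma bij_betw_shift:
  assumes "0 < n"
  shows "bij_betw (\<lambda>xs. map (\<lambda>(p, q). (p - q, q)) (tl xs))
    {xs \<in> farey_paths (Suc n) m. xs ! 1 = (1, 1)} (farey_paths n (m - 1))"
    (is "bij_betw ?f ?A ?B")
proof (rule bij_betw_byWitness[where f' = "\<lambda>xs. (0, 1) # map (\<lambda>(p, q). (p + q, q)) xs"])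
  show "\<forall>xs\<in>?A. (0, 1) # map (\<lambda>(p, q). (p + q, q)) (?f xs) = xs"
  proof
    fix xs assume "xs \<in> ?A"
    then show "(0, 1) # map (\<lambda>(p, q). (p + q, q)) (?f xs) = xs"
      by (cases xs) (auto simp: farey_paths_def comp_def case_prod_unfold)
  qed
  show "\<forall>xs\<in>?B. ?f ((0, 1) # map (\<lambda>(p, q). (p + q, q)) xs) = xs"
    by (auto simp: comp_def case_prod_unfold)
  show "?f ` ?A \<subseteq> ?B"
    using assms by (auto simp: farey_paths_def nth_tl case_prod_unfold algebra_simps)
  show "(\<lambda>xs. (0, 1) # map (\<lambda>(p, q). (p + q, q)) xs) ` ?B \<subseteq> ?A"
    using assms
    by (auto simp: farey_paths_def nth_Cons case_prod_unfold algebra_simps split: nat.splits)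
qed

section \<open>Counting Farey paths\<close>

lemma card_farey_paths_rec:
  assumes "0 < n" "1 \<le> m" "finite (farey_paths n (m - 1))" "finite (farey_paths (Suc n) (m + 1))"
  shows "finite (farey_paths (Suc n) m)"
    and "card (farey_paths (Suc n) m) = card (farey_paths n (m - 1)) + card (farey_paths (Suc n) (m + 1))"
proof -
  let ?A = "{xs \<in> farey_paths (Suc n) m. xs ! 1 = (1, 1)}"
  let ?B = "{xs \<in> farey_paths (Suc n) m. xs ! 1 \<noteq> (1, 1)}"
  have un: "farey_paths (Suc n) m = ?A \<union> ?B" "?A \<inter> ?B = {}" by auto
  have bij: "bij_betw (\<lambda>xs. map (\<lambda>(p, q). (p - q, q)) (tl xs)) ?A (farey_paths n (m - 1))"
    "bij_betw (map flip) ?B (farey_paths (Suc n) (m + 1))"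
    using bij_betw_shift bij_betw_flip assms by auto
  then have fin: "finite ?A" "finite ?B" using assms bij_betw_finite by blast+
  then show "finite (farey_paths (Suc n) m)" by (subst un) blast
  show "card (farey_paths (Suc n) m) = card (farey_paths n (m - 1)) + card (farey_paths (Suc n) (m + 1))"
    using bij[THEN bij_betw_same_card] card_Un_disjoint[OF fin un(2)] un(1) by simp
qed

lemma farey_paths_2_1: "farey_paths 2 1 = {[(0, 1), (1, 1)]}"
proof -
  have "xs = [(0, 1), (1, 1)]" if "xs \<in> farey_paths 2 1" for xs
    using that by (intro nth_equalityI) (auto simp: farey_paths_def less_2_cases_iff)
  moreover have "[(0, 1), (1, 1)] \<in> farey_paths 2 1"
    by (auto simp: farey_paths_def less_2_cases_iff)
  ultimately show ?thesis by blast
qed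

text \<open>Outer induction on \<open>n\<close>, inner on \<open>k\<close>. The range includes
  \<open>k = Suc n\<close>, one beyond the diagonal, where the target is 0 and both counts vanish;
  the recurrence on the next diagonal refers to it.\<close>

lemma farey_paths_ballot:
  assumes "k \<le> Suc n"
  shows "finite (farey_paths (n + 2) (int n + 1 - int k)) \<and>
    card (farey_paths (n + 2) (int n + 1 - int k)) = ballot n k"
  using assms
proof (induction n arbitrary: k)
  case 0
  then consider "k = 0" | "k = 1" by linarith
  then show ?case
    by cases (simp_all add: farey_paths_2_1 ballot_origin ballot_above
      farey_paths_empty_nonpos numeral_2_eq_2[symmetric])
next
  case (Suc n)
  note IHn = Suc.IH
  from Suc.prems show ?case
  proof (induction k)
    case 0
    \<comment> \<open>For \<open>k = 0\<close> the second summand of the recurrence has a target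
      equal to the number of vertices, which is out of reach.\<close>
    have "farey_paths (Suc (n + 2)) (int n + 2 + 1) = {}"
      by (rule farey_paths_empty_large) auto
    then show ?case
      using card_farey_paths_rec[of "n + 2" "int n + 2"] IHn[of 0]
      by (simp add: ballot_Suc_0 algebra_simps)
  next
    case (Suc k)
    show ?case
    proof (cases "k = Suc n")
      case True
      then show ?thesis by (simp add: farey_paths_empty_nonpos ballot_above)
    next
      case False
      with Suc.prems have "k \<le> n" by simp
      then show ?thesis
        using card_farey_paths_rec[of "n + 2" "int n + 1 - int k"] IHn[of "Suc k"] Suc.IH
        by (simp add: ballot_Suc_Suc algebra_simps)
    qed
  qed
qed

section \<open>Continuants\<close>

text \<open>
  The entries of \<open>r\<close> with \<open>r\<^sub>0 = 0\<close> adjoined and \<open>r\<^sub>1 = 1\<close>, as functions of \<open>d\<close>: \<open>a j\<close>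
  is the entry of vertex \<open>j + 1\<close>, so \<open>continuant a j\<close> belongs to vertex \<open>j\<close>.
\<close>

fun continuant :: "(nat \<Rightarrow> int) \<Rightarrow> nat \<Rightarrow> int" where
  "continuant a 0 = 0"
| "continuant a (Suc 0) = 1"
| "continuant a (Suc (Suc j)) = a j * continuant a (Suc j) - continuant a j"

lemma continuant_cong: "(\<And>i. Suc i < j \<Longrightarrow> a i = b i) \<Longrightarrow> continuant a j = continuant b j"
  by (induction a j rule: continuant.induct) auto

text \<open>Continuants are tridiagonal determinants, expanded here at the first entry instead of
  the last. This later recovers the entry dropped by a rotation.\<close>

lemma continuant_Suc_Suc_left:
  "continuant a (Suc (Suc j)) = a 0 * continuant (a \<circ> Suc) (Suc j) - continuant (a \<circ> Suc \<circ> Suc) j"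
proof -
  define b c where "b = a \<circ> Suc" and "c = b \<circ> Suc"
  then have shift: "b i = a (Suc i)" "c i = a (Suc (Suc i))" for i by simp_all
  have "continuant a (Suc (Suc j)) = a 0 * continuant b (Suc j) - continuant c j"
  proof (induction j rule: induct_nat_012)
    case (ge2 j)
    show ?case
      unfolding continuant.simps(3)[of a "Suc (Suc j)"] continuant.simps(3)[of b "Suc j"]
        continuant.simps(3)[of c j] ge2 shift(1)[of "Suc j"] shift(2)[of j]
      by (simp add: algebra_simps del: continuant.simps)
  qed (simp_all add: shift)
  then show ?thesis by (simp only: b_def c_def)
qed

text \<open>Both sequences solve the same second-order recurrence, the shifted one with index
  lagging by one, so their Casoratian keeps its initial value 1.\<close>

lemma continuant_det:
  "continuant (a \<circ> Suc) (Suc j) * continuant a (Suc j) - continuant (a \<circ> Suc) j * continuant a (Suc (Suc j)) = 1"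
  by (induction j) (auto simp: algebra_simps)

section \<open>Arithmetical structures through continuants\<close>

lemma path_adj_index:
  assumes "j < n" "l < n"
  shows "path_adj n $$ (j, l) = (if l = Suc j \<or> j = Suc l then 1 else 0)"
proof -
  have "{j + 1, l + 1} \<in> path_edges n \<longleftrightarrow> l = Suc j \<or> j = Suc l"
    using assms by (auto simp: path_edges_def doubleton_eq_iff)
  then show ?thesis using assms by (simp add: path_adj_def)
qed

lemma laplacian_mult_index:
  assumes "r \<in> carrier_vec n" "j < n"
  shows "((mat_diag n (\<lambda>j. d $ j) - path_adj n) *\<^sub>v r) $ j =
    d $ j * r $ j - (if Suc j < n then r $ Suc j else 0) - (if 0 < j then r $ (j - 1) else 0)"
proof -
  \<comment> \<open>The last indicator is \<open>Suc l = j\<close>, since \<open>l = j - 1\<close>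
    would wrongly hit \<open>l = 0\<close> in row 0.\<close>
  let ?g = "\<lambda>l. (if l = j then d $ j * r $ j else 0) - (if l = Suc j then r $ Suc j else 0)
    - (if Suc l = j then r $ (j - 1) else 0)"
  have dim: "path_adj n \<in> carrier_mat n n" by (simp add: path_adj_def)
  have "((mat_diag n (\<lambda>j. d $ j) - path_adj n) *\<^sub>v r) $ j
      = (\<Sum>l\<in>{0..<n}. (mat_diag n (\<lambda>j. d $ j) - path_adj n) $$ (j, l) * r $ l)"
    using assms dim by (simp add: scalar_prod_def)
  also have "\<dots> = (\<Sum>l\<in>{0..<n}. ?g l)"
    using assms dim by (intro sum.cong) (auto simp: path_adj_index mat_diag_def)
  also have "\<dots> = d $ j * r $ j - (if Suc j < n then r $ Suc j else 0) - (if 0 < j then r $ (j - 1) else 0)"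
    using assms(2) by (cases j) (auto simp: sum_subtractf)
  finally show ?thesis .
qed

lemma Gcd_vec_multiple:
  fixes r :: "int vec"
  assumes "r \<in> carrier_vec n" "0 < n" "\<And>j. j < n \<Longrightarrow> r $ 0 dvd r $ j"
  shows "Gcd (set\<^sub>v r) = \<bar>r $ 0\<bar>"
proof -
  have "r $ 0 \<in> set\<^sub>v r" "\<forall>x\<in>set\<^sub>v r. r $ 0 dvd x"
    using assms by (auto simp: vec_set_def in_set_conv_nth)
  then have "Gcd (set\<^sub>v r) dvd r $ 0" "r $ 0 dvd Gcd (set\<^sub>v r)" by auto
  then show ?thesis by (metis abs_Gcd_eq abs_dvd_iff dvd_abs_iff zdvd_antisym_abs)
qed

text \<open>The rows express \<open>r\<close> as its first entry times the continuants; primitivity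
  makes that entry 1, and the last row becomes the vanishing condition.\<close>

lemma arith_d_structures_iff:
  assumes "2 \<le> n"
  shows "d \<in> arith_d_structures n \<longleftrightarrow> d \<in> carrier_vec n \<and>
    (\<forall>j\<in>{1..n}. 0 < continuant (\<lambda>i. d $ i) j) \<and> continuant (\<lambda>i. d $ i) (Suc n) = 0"
    (is "_ \<longleftrightarrow> _ \<and> (\<forall>j\<in>_. 0 < ?K j) \<and> _")
proof
  assume "d \<in> arith_d_structures n"
  then obtain r where r: "arith_structure n d r" by (auto simp: arith_d_structures_def)
  then have car: "d \<in> carrier_vec n" "r \<in> carrier_vec n"
    and pos: "\<And>j. j < n \<Longrightarrow> 0 < r $ j" and gcd: "Gcd (set\<^sub>v r) = 1"
    and ker: "(mat_diag n (\<lambda>j. d $ j) - path_adj n) *\<^sub>v r = 0\<^sub>v n"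
    by (auto simp: arith_structure_def)
  have rel: "d $ j * r $ j - (if Suc j < n then r $ Suc j else 0) - (if 0 < j then r $ (j - 1) else 0) = 0"
    if "j < n" for j
    using laplacian_mult_index[OF car(2) that, of d] ker that by simp
  \<comment> \<open>The case \<open>j = n\<close> is a phantom entry 0 behind the last vertex; it
    encodes the last row.\<close>
  have eq: "(if j < n then r $ j else 0) = r $ 0 * ?K (Suc j)" if "j \<le> n" for j
    using that
  proof (induction j rule: less_induct)
    case (less j)
    consider "j = 0" | "j = 1" | l where "j = Suc (Suc l)" by (metis One_nat_def not0_implies_Suc)
    then show ?case
    proof cases
      case 1
      then show ?thesis using assms by simp
    next
      case 2
      then show ?thesis using rel[of 0] assms by (simp add: mult.commute)
    next
      case 3
      then show ?thesis
        using rel[of "Suc l"] less.IH[of l] less.IH[of "Suc l"] less.prems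
        by (simp add: continuant.simps(3)[of "\<lambda>i. d $ i" "Suc l"] algebra_simps del: continuant.simps)
    qed
  qed
  have "r $ 0 dvd r $ j" if "j < n" for j
    using eq[of j] that by simp
  then have "r $ 0 = 1"
    using Gcd_vec_multiple[OF car(2)] pos[of 0] gcd assms by simp
  then have "0 < ?K j" if "j \<in> {1..n}" for j
    using eq[of "j - 1"] pos[of "j - 1"] that by (cases j) auto
  moreover have "?K (Suc n) = 0" using eq[of n] pos[of 0] assms by auto
  ultimately show "d \<in> carrier_vec n \<and> (\<forall>j\<in>{1..n}. 0 < ?K j) \<and> ?K (Suc n) = 0" using car by blast
next
  assume d: "d \<in> carrier_vec n \<and> (\<forall>j\<in>{1..n}. 0 < ?K j) \<and> ?K (Suc n) = 0"
  define r where "r = vec n (\<lambda>j. ?K (Suc j))"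
  have car: "r \<in> carrier_vec n" by (simp add: r_def)
  have nonneg: "0 \<le> ?K j" if "j \<le> Suc n" for j
  proof -
    have "j = 0 \<or> j \<in> {1..n} \<or> j = Suc n" using that by auto
    then show ?thesis using d by fastforce
  qed
  \<comment> \<open>The recurrence gives
    \<open>d $ j * ?K (Suc j) = ?K j + ?K (Suc (Suc j))\<close>; both summands are nonnegative and,
    as n \<ge> 2, not both zero.\<close>
  have "0 < d $ j" if "j < n" for j
  proof -
    have "j \<in> {1..n} \<or> Suc (Suc j) \<in> {1..n}" using that assms by auto
    then have "0 < ?K j \<or> 0 < ?K (Suc (Suc j))" using d by blast
    then have "0 < ?K j + ?K (Suc (Suc j))"
      using nonneg[of j] nonneg[of "Suc (Suc j)"] that by auto
    then have "0 < d $ j * ?K (Suc j)" by simp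
    moreover have "0 < ?K (Suc j)" using d that by simp
    ultimately show ?thesis by (rule zero_less_mult_pos2)
  qed
  moreover have "0 < r $ j" if "j < n" for j using d that by (simp add: r_def)
  moreover have "r $ 0 = 1" using assms by (simp add: r_def)
  then have "Gcd (set\<^sub>v r) = 1" using Gcd_vec_multiple[OF car] assms by simp
  moreover have "(mat_diag n (\<lambda>j. d $ j) - path_adj n) *\<^sub>v r = 0\<^sub>v n"
  proof (rule eq_vecI)
    fix j assume j: "j < dim_vec (0\<^sub>v n :: int vec)"
    then have rj: "(if Suc j < n then r $ Suc j else 0) = ?K (Suc (Suc j))"
      using d by (cases "Suc j < n") (auto simp: r_def less_Suc_eq dest: Suc_lessI)
    have "(if 0 < j then r $ (j - 1) else 0) = ?K j"
      using j by (cases j) (auto simp: r_def)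
    then show "((mat_diag n (\<lambda>j. d $ j) - path_adj n) *\<^sub>v r) $ j = 0\<^sub>v n $ j"
      using laplacian_mult_index[OF car, of j d] rj j by (simp add: r_def)
  qed (simp add: path_adj_def)
  ultimately show "d \<in> arith_d_structures n"
    using d car by (auto simp: arith_d_structures_def arith_structure_def)
qed

text \<open>\<open>continuant_det\<close> carries positivity along the shifted sequence. At the end,
  where \<open>continuant a (Suc n)\<close> is 0, it makes a product of two positive integers equal
  to 1.\<close>

lemma arith_d_tail_continuant:
  assumes "2 \<le> n" "d \<in> arith_d_structures n"
  defines "a \<equiv> \<lambda>i. d $ i"
  shows "\<And>j. j \<in> {1..n} \<Longrightarrow> 0 < continuant (a \<circ> Suc) j"
    and "continuant (a \<circ> Suc) n = 1" and "continuant a n = 1"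
proof -
  have d: "\<And>j. j \<in> {1..n} \<Longrightarrow> 0 < continuant a j" "continuant a (Suc n) = 0"
    using assms(2) arith_d_structures_iff[OF assms(1)] by (auto simp: a_def)
  define b where "b = a \<circ> Suc"
  have det: "continuant b (Suc j) * continuant a (Suc j) = 1 + continuant b j * continuant a (Suc (Suc j))" for j
    using continuant_det[of a j] unfolding b_def by linarith
  have "Suc j \<le> n \<Longrightarrow> 0 < continuant b (Suc j)" for j
  proof (induction j)
    case (Suc j)
    have "Suc (Suc j) = n \<or> Suc (Suc (Suc j)) \<in> {1..n}" using Suc.prems by auto
    then have "0 \<le> continuant a (Suc (Suc (Suc j)))"
      using d by (metis less_imp_le order_refl)
    moreover have "0 < continuant b (Suc j)"
      using Suc by simp
    ultimately have "0 < continuant b (Suc (Suc j)) * continuant a (Suc (Suc j))"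
      unfolding det by (intro add_pos_nonneg mult_nonneg_nonneg) auto
    moreover have "0 < continuant a (Suc (Suc j))" using Suc.prems by (intro d(1)) simp
    ultimately show ?case by (rule zero_less_mult_pos2)
  qed simp
  then have pos: "Suc j \<le> n \<Longrightarrow> 0 < continuant (a \<circ> Suc) (Suc j)" for j
    by (simp only: b_def)
  show pos': "0 < continuant (a \<circ> Suc) j" if "j \<in> {1..n}" for j
    using pos[of "j - 1"] that by (cases j) (auto simp del: continuant.simps)
  obtain n' where n': "n = Suc n'" using assms(1) by (cases n) auto
  have "continuant (a \<circ> Suc) n * continuant a n = 1"
    using continuant_det[of a n'] d(2) by (simp add: n' del: continuant.simps)
  then show "continuant (a \<circ> Suc) n = 1" "continuant a n = 1"
    using pos'[of n] d(1)[of n] assms(1) by (auto simp: zmult_eq_1_iff)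
qed

section \<open>The cyclic shift\<close>

text \<open>The new last entry is the \<open>d\<^sub>0\<close> of the frieze cycle: on a d-structure
  the shifted continuant at \<open>n\<close> is 1, so this is the only value making the next one
  vanish.\<close>

definition rotate_d :: "nat \<Rightarrow> int vec \<Rightarrow> int vec" where
  "rotate_d n d = vec n (\<lambda>j. if Suc j < n then d $ Suc j else continuant ((\<lambda>i. d $ i) \<circ> Suc) j)"

lemma rotate_d_in:
  assumes "2 \<le> n" "d \<in> arith_d_structures n"
  shows "rotate_d n d \<in> arith_d_structures n"
proof -
  note tail = arith_d_tail_continuant[OF assms]
  let ?a = "(\<lambda>i. d $ i) \<circ> Suc" and ?b = "\<lambda>i. rotate_d n d $ i"
  have eq: "continuant ?b j = continuant ?a j" if "j \<le> n" for j
    using that by (intro continuant_cong) (auto simp: rotate_d_def)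
  obtain n' where n': "n = Suc n'" using assms(1) by (cases n) auto
  have "?b n' = continuant ?a n'" by (simp add: rotate_d_def n')
  then have "continuant ?b (Suc n) = 0"
    using eq[of n'] eq[of n] tail(2) by (simp add: n')
  then show ?thesis using tail(1) eq
    by (auto simp: arith_d_structures_iff[OF assms(1)] rotate_d_def)
qed

text \<open>Only the first entry is dropped. Expanding the vanishing continuant at that entry, whose
  coefficient is 1, writes it as a continuant of entries that are kept.\<close>

lemma inj_on_rotate_d:
  assumes "2 \<le> n"
  shows "inj_on (rotate_d n) (arith_d_structures n)"
proof (rule inj_onI)
  fix d e assume de: "d \<in> arith_d_structures n" "e \<in> arith_d_structures n" "rotate_d n d = rotate_d n e"
  have car: "d \<in> carrier_vec n" "e \<in> carrier_vec n" using de arith_d_structures_iff[OF assms] by auto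
  obtain n' where n': "n = Suc n'" using assms by (cases n) auto
  have tl: "d $ Suc j = e $ Suc j" if "Suc j < n" for j
    using arg_cong[OF de(3), of "\<lambda>v. v $ j"] that by (simp add: rotate_d_def)
  have hd: "x $ 0 = continuant ((\<lambda>i. x $ i) \<circ> Suc \<circ> Suc) n'" if "x \<in> arith_d_structures n" for x
    using continuant_Suc_Suc_left[of "\<lambda>i. x $ i" n'] arith_d_tail_continuant(2)[OF assms that]
      that arith_d_structures_iff[OF assms, of x] by (simp add: n' del: continuant.simps)
  have "continuant ((\<lambda>i. d $ i) \<circ> Suc \<circ> Suc) n' = continuant ((\<lambda>i. e $ i) \<circ> Suc \<circ> Suc) n'"
    using tl by (intro continuant_cong) (auto simp: n')
  then have "d $ 0 = e $ 0" using hd de by metis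
  then have "d $ j = e $ j" if "j < n" for j using tl that by (cases j) auto
  then show "d = e" using car by (intro eq_vecI) auto
qed

section \<open>d-structures as Farey paths\<close>

definition farey_path_of :: "nat \<Rightarrow> int vec \<Rightarrow> (int \<times> int) list" where
  "farey_path_of n d =
     map (\<lambda>j. (continuant ((\<lambda>i. d $ i) \<circ> Suc) j, continuant (\<lambda>i. d $ i) (Suc j))) [0..<n]"

text \<open>The steps are instances of \<open>continuant_det\<close>, and the last numerator is by
  construction the entry that the rotation creates.\<close>

lemma farey_path_of_in:
  assumes "2 \<le> n" "d \<in> arith_d_structures n"
  shows "farey_path_of n d \<in> farey_paths n (rotate_d n d $ (n - 1))"
proof -
  have "0 < continuant (\<lambda>i. d $ i) (Suc j)" if "j < n" for j
    using that assms(2) arith_d_structures_iff[OF assms(1), of d] by auto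
  then show ?thesis
    using arith_d_tail_continuant(3)[OF assms] assms(1) continuant_det
    by (auto simp: farey_paths_def farey_path_of_def rotate_d_def simp del: continuant.simps(3))
qed

text \<open>The denominators alone give all continuants, and dividing in their recurrence gives the
  entries.\<close>

lemma inj_on_farey_path_of:
  assumes "2 \<le> n"
  shows "inj_on (farey_path_of n) (arith_d_structures n)"
proof (rule inj_onI)
  fix d e assume de: "d \<in> arith_d_structures n" "e \<in> arith_d_structures n"
    and eq: "farey_path_of n d = farey_path_of n e"
  let ?a = "\<lambda>i. d $ i" and ?b = "\<lambda>i. e $ i"
  have pos: "\<And>j. j \<in> {1..n} \<Longrightarrow> 0 < continuant ?a j"
    and zero: "continuant ?a (Suc n) = 0" "continuant ?b (Suc n) = 0"
    and car: "d \<in> carrier_vec n" "e \<in> carrier_vec n"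
    using de arith_d_structures_iff[OF assms] by auto
  have K: "continuant ?a j = continuant ?b j" if j: "j \<le> Suc n" for j
  proof -
    consider "j = 0" | "j = Suc n" | i where "j = Suc i" "i < n" 
      using j by (cases j) (auto simp: le_less)
    then show ?thesis
    proof cases
      case 3
      then show ?thesis using arg_cong[OF eq, of "\<lambda>xs. snd (xs ! i)"]
        by (simp add: farey_path_of_def del: continuant.simps)
    qed (simp_all only: zero continuant.simps)
  qed
  have "d $ j = e $ j" if "j < n" for j
  proof -
    have "d $ j * continuant ?a (Suc j) = e $ j * continuant ?a (Suc j)"
      using K[of j] K[of "Suc j"] K[of "Suc (Suc j)"] that by simp
    then show ?thesis using pos[of "Suc j"] that by simp
  qed
  then show "d = e" using car by (intro eq_vecI) auto
qed

text \<open>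
  The entry of an interior vertex is \<open>(q\<^sub>j\<^sub>-\<^sub>1 + q\<^sub>j\<^sub>+\<^sub>1) / q\<^sub>j\<close>; it is written below as the determinant
  of the two neighbouring fractions, which is visibly an integer.
\<close>

lemma farey_path_of_surj:
  assumes "2 \<le> n" and xs: "xs \<in> farey_paths n m"
  shows "\<exists>d\<in>arith_d_structures n. farey_path_of n d = xs"
proof -
  define p q where pq: "p = (\<lambda>j. fst (xs ! j))" "q = (\<lambda>j. snd (xs ! j))"
  have len: "length xs = n" and ends: "p 0 = 0" "q 0 = 1" "q (n - 1) = 1"
    and pos: "\<And>j. j < n \<Longrightarrow> 0 < q j"
    and det: "\<And>j. Suc j < n \<Longrightarrow> p (Suc j) * q j - p j * q (Suc j) = 1"
    using xs by (auto simp: farey_paths_def pq)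
  \<comment> \<open>At either end one neighbour is missing and the own denominator is 1, which
    leaves the denominator of the other neighbour.\<close>
  define d where "d = vec n (\<lambda>j. if j = 0 then q 1 else if Suc j = n then q (j - 1)
    else p (Suc j) * q (j - 1) - p (j - 1) * q (Suc j))"
  let ?a = "\<lambda>i. d $ i"
  have p1: "p 1 = 1" using det[of 0] ends assms(1) by simp
  \<comment> \<open>Plane vectors satisfy det(u, w) v = det(v, w) u + det(u, v) w; for three
    consecutive vertices both coefficients on the right are 1.\<close>
  have mid: "p (Suc (Suc j)) = d $ Suc j * p (Suc j) - p j" "q (Suc (Suc j)) = d $ Suc j * q (Suc j) - q j"
    if "Suc (Suc j) < n" for j
  proof -
    have dj: "d $ Suc j = p (Suc (Suc j)) * q j - p j * q (Suc (Suc j))"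
      using that by (simp add: d_def)
    have e: "p (Suc j) * q j = 1 + p j * q (Suc j)"
      "p (Suc j) * q (Suc (Suc j)) = p (Suc (Suc j)) * q (Suc j) - 1"
      using det[of j] det[of "Suc j"] that by auto
    have "d $ Suc j * p (Suc j) = p (Suc (Suc j)) * (p (Suc j) * q j) - p j * (p (Suc j) * q (Suc (Suc j)))"
      by (simp add: dj algebra_simps)
    also have "\<dots> = p (Suc (Suc j)) + p j" unfolding e by (simp add: algebra_simps)
    finally show "p (Suc (Suc j)) = d $ Suc j * p (Suc j) - p j" by simp
    have e': "p (Suc (Suc j)) * q (Suc j) = 1 + p (Suc j) * q (Suc (Suc j))"
      "p j * q (Suc j) = p (Suc j) * q j - 1"
      using e by auto
    have "d $ Suc j * q (Suc j) = (p (Suc (Suc j)) * q (Suc j)) * q j - (p j * q (Suc j)) * q (Suc (Suc j))"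
      by (simp add: dj algebra_simps)
    also have "\<dots> = q (Suc (Suc j)) + q j" unfolding e' by (simp add: algebra_simps)
    finally show "q (Suc (Suc j)) = d $ Suc j * q (Suc j) - q j" by simp
  qed
  have d0: "d $ 0 = q 1" using assms(1) by (simp add: d_def)
  have Kq: "Suc j < n \<Longrightarrow> continuant ?a (Suc j) = q j \<and> continuant ?a (Suc (Suc j)) = q (Suc j)" for j
  proof (induction j)
    case (Suc j)
    then show ?case
      using mid(2)[of j] continuant.simps(3)[of ?a "Suc j"] by (simp del: continuant.simps)
  qed (simp add: ends d0)
  have Kp: "Suc j < n \<Longrightarrow> continuant (?a \<circ> Suc) j = p j \<and> continuant (?a \<circ> Suc) (Suc j) = p (Suc j)" for j
  proof (induction j)
    case (Suc j)
    then show ?case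
      using mid(1)[of j] continuant.simps(3)[of "?a \<circ> Suc" j]
      by (simp add: comp_def del: continuant.simps)
  qed (simp add: ends p1[simplified])
  have K: "continuant ?a (Suc j) = q j" "continuant (?a \<circ> Suc) j = p j" if "j < n" for j
    using Kq[of "j - 1"] Kp[of "j - 1"] that by (cases j; simp add: ends del: continuant.simps(3))+
  obtain l where l: "n = Suc (Suc l)" using assms(1) by (metis add_2_eq_Suc le_Suc_ex)
  have "d $ Suc l = q l" by (simp add: d_def l)
  then have "continuant ?a (Suc n) = 0"
    using K(1)[of l] K(1)[of "Suc l"] ends(3) continuant.simps(3)[of ?a "Suc l"]
    by (simp add: l del: continuant.simps)
  moreover have "0 < continuant ?a j" if "j \<in> {1..n}" for j
    using K(1)[of "j - 1"] pos[of "j - 1"] that by (cases j) auto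
  ultimately have "d \<in> arith_d_structures n"
    by (auto simp: arith_d_structures_iff[OF assms(1)] d_def)
  moreover have "farey_path_of n d = xs"
    by (rule nth_equalityI) (simp_all add: farey_path_of_def len K pq)
  ultimately show ?thesis by blast
qed

section \<open>Comparing the counts\<close>

lemma farey_paths_unique: "xs \<in> farey_paths n m \<Longrightarrow> xs \<in> farey_paths n m' \<Longrightarrow> m = m'"
  by (auto simp: farey_paths_def)

lemma finite_farey_paths:
  assumes "2 \<le> n"
  shows "finite (farey_paths n m)"
proof (cases "0 \<le> m \<and> m < int n")
  case True
  then have "nat (int n - 1 - m) \<le> Suc (n - 2)" "int (n - 2) + 1 - int (nat (int n - 1 - m)) = m" "n - 2 + 2 = n"
    using assms by auto
  then show ?thesis using farey_paths_ballot[of "nat (int n - 1 - m)" "n - 2"] by simp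
next
  case False
  then show ?thesis using assms farey_paths_empty_nonpos[of n m] farey_paths_empty_large[of n m] by auto
qed

text \<open>The endpoints of the associated Farey paths are bounded. Finiteness then turns the
  injective rotation into a permutation.\<close>

lemma finite_arith_d_structures:
  assumes "2 \<le> n"
  shows "finite (arith_d_structures n)"
proof -
  have "farey_path_of n ` arith_d_structures n \<subseteq> (\<Union>m\<in>{0..int n}. farey_paths n m)"
  proof (intro image_subsetI)
    fix d assume d: "d \<in> arith_d_structures n"
    let ?m = "rotate_d n d $ (n - 1)"
    note P = farey_path_of_in[OF assms d]
    have "?m \<in> {0..int n}"
      using P assms farey_paths_empty_nonpos[of n ?m] farey_paths_empty_large[of n ?m]
      by (cases "?m \<le> 0"; cases "int n \<le> ?m") auto
    with P show "farey_path_of n d \<in> (\<Union>m\<in>{0..int n}. farey_paths n m)" by blast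
  qed
  then have "finite (farey_path_of n ` arith_d_structures n)"
    by (rule finite_subset) (simp add: finite_farey_paths[OF assms])
  then show ?thesis using inj_on_farey_path_of[OF assms] finite_imageD by blast
qed

lemma rotate_d_image:
  assumes "2 \<le> n"
  shows "rotate_d n ` arith_d_structures n = arith_d_structures n"
  using assms by (intro endo_inj_surj finite_arith_d_structures inj_on_rotate_d) (auto intro: rotate_d_in)

lemma card_rotate_d:
  assumes "2 \<le> n"
  shows "card {d \<in> arith_d_structures n. P (rotate_d n d)} = card {d \<in> arith_d_structures n. P d}"
proof -
  have "{d \<in> rotate_d n ` arith_d_structures n. P d} =
      rotate_d n ` {d \<in> arith_d_structures n. P (rotate_d n d)}"
    by auto
  then have "{d \<in> arith_d_structures n. P d} = rotate_d n ` {d \<in> arith_d_structures n. P (rotate_d n d)}"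
    unfolding rotate_d_image[OF assms] .
  moreover have "inj_on (rotate_d n) {d \<in> arith_d_structures n. P (rotate_d n d)}"
    using inj_on_rotate_d[OF assms] by (rule inj_on_subset) auto
  ultimately show ?thesis by (simp add: card_image)
qed

text \<open>Rotation moves the entry at \<open>Suc j\<close> to \<open>j\<close>, so adjacent
  positions have equal distributions; the induction descends from the last position.\<close>

lemma card_entry_eq_last:
  assumes "2 \<le> n" "j < n"
  shows "card {d \<in> arith_d_structures n. d $ j = m} = card {d \<in> arith_d_structures n. d $ (n - 1) = m}"
proof -
  have "j \<le> n - 1" using assms by simp
  then show ?thesis
  proof (induction j rule: inc_induct)
    case (step j)
    have "{d \<in> arith_d_structures n. rotate_d n d $ j = m} = {d \<in> arith_d_structures n. d $ Suc j = m}"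
      using step.hyps by (auto simp: rotate_d_def)
    then show ?case using step.IH card_rotate_d[OF assms(1), of "\<lambda>d. d $ j = m"] by simp
  qed simp
qed

text \<open>Rotation trades the last entry of \<open>d\<close> for that of
  \<open>rotate_d n d\<close>, which is the endpoint of the Farey path of \<open>d\<close>.\<close>

lemma card_last_entry:
  assumes "2 \<le> n"
  shows "card {d \<in> arith_d_structures n. d $ (n - 1) = m} = card (farey_paths n m)"
proof -
  let ?A = "{d \<in> arith_d_structures n. rotate_d n d $ (n - 1) = m}"
  have "farey_path_of n ` ?A = farey_paths n m"
  proof (intro equalityI subsetI)
    fix xs assume xs: "xs \<in> farey_paths n m"
    then obtain d where d: "d \<in> arith_d_structures n" "farey_path_of n d = xs"
      using farey_path_of_surj[OF assms] by blast
    then show "xs \<in> farey_path_of n ` ?A"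
      using farey_path_of_in[OF assms d(1)] farey_paths_unique xs by blast
  qed (use farey_path_of_in[OF assms] in auto)
  moreover have "inj_on (farey_path_of n) ?A"
    using inj_on_farey_path_of[OF assms] by (rule inj_on_subset) auto
  ultimately have "card ?A = card (farey_paths n m)" using card_image by fastforce
  then show ?thesis using card_rotate_d[OF assms, of "\<lambda>d. d $ (n - 1) = m"] by simp
qed

theorem theorem2p17:
  fixes n i k :: nat
  assumes "n \<ge> 2"
    and "i \<in> {1..n}"
    and "k \<le> n - 2"
  shows "card {d \<in> arith_d_structures n. d $ (i - 1) = int n - int k - 1} = ballot (n - 2) k"
proof -
  have n: "n - 2 + 2 = n" "int (n - 2) + 1 - int k = int n - int k - 1" using assms(1) by auto
  moreover have "i - 1 < n" using assms(2) by auto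
  ultimately show ?thesis
    using card_entry_eq_last[of n "i - 1" "int n - int k - 1"]
      card_last_entry[of n "int n - int k - 1"] farey_paths_ballot[of k "n - 2", unfolded n] assms by linarith
qed

end
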